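(* Let $\{\mathcal{L}_n\}$, $u_i^{\mathcal{R}}$, $u_i^{\mathcal{L}}$, $\chi_i^{\mathcal{R}}$, $\chi_i^{\mathcal{L}}$ be as defined in the context, let $n\ge1$, and let $x_j^{(n)}$, $j=1,2,\ldots,n$, be the zeros of $\mathcal{L}_n(x)$. With the weight function $\omega_{n,j,k}$ given by $$\omega_{n,j,k}^{-1}=-\sqrt{d_n}\,(x_k^{(n)}-i\omega)\,[u_n^{\mathcal{R}}]'(x_k^{(n)})\,u_{n-1}^{\mathcal{L}}(x_j^{(n)})\neq0,\quad j,k=1,\ldots,n,$$ the following biorthogonality relation holds: $$\sum_{i=0}^{n-1}\chi_i^{\mathcal{L}}(x_j^{(n)})\,\chi_i^{\mathcal{R}}(x_k^{(n)})\,\omega_{n,j,k}=\delta_{j,k},\quad j,k=1,2,\ldots,n.$$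
   Context: Setting: $\omega\in\mathbb{R}\setminus\{0\}$; $\{\rho_n\}_{n\ge0}$, $\{c_n\}_{n\ge0}$ are real sequences with $\rho_n\ge1$; $\{d_n\}_{n\ge1}$ is a positive chain sequence, i.e. there is $\{\xi_n\}_{n\ge0}$ with $0\le\xi_0<1$, $0<\xi_n<1$ $(n\ge1)$ and $d_n=(1-\xi_{n-1})\xi_n$. The polynomials $\mathcal{P}_n$ are generated by $\mathcal{P}_{-1}=0$, $\mathcal{P}_0=1$, $\mathcal{P}_1=\rho_0(x-c_0)$, $\mathcal{P}_{n+1}=\rho_n(x-c_n)\mathcal{P}_n-d_n(x^2+\omega^2)\mathcal{P}_{n-1}$ $(n\ge1)$, and $\mathcal{L}_n=\mathcal{P}_n-\alpha_n\mathcal{P}_{n-1}$ with nonzero real $\alpha_n$ satisfying, for all $n\ge1$, $$\alpha_n=\rho_{n-1}(1-c_{n-1})-\omega^2\alpha_{n-1}^{-1}d_{n-1},\qquad d_n\alpha_{n-1}\rho_{n-1}=d_{n-1}\alpha_n\rho_n$$ ($d_0$ and $\alpha_0\ne0$ are auxiliary real constants not influencing the polynomials). Under these conditions $\mathcal{L}_0=1$, $\mathcal{L}_1=\rho_0(x-\alpha_1\rho_0^{-1}-c_0)$ and $\mathcal{L}_{n+1}=\rho_n\bigl(x-f_n^{-1}s_n/\rho_n\bigr)\mathcal{L}_n-d_n(x^2+\omega^2)\mathcal{L}_{n-1}$ for $n\ge1$, where $f_n=-\alpha_{n-1}\rho_{n-1}$ and $s_n=-(\alpha_{n-1}\rho_{n-1}c_{n-1}+d_{n-1}\omega^2)(\rho_nc_n+\alpha_{n+1})+\alpha_{n-1}d_n\omega^2$.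 Rational functions: $u_0^{\mathcal{R}}=u_0^{\mathcal{L}}=\mathcal{L}_0$ and for $k\ge1$ $$u_k^{\mathcal{R}}(x)=\frac{(-1)^k\mathcal{L}_k(x)}{(x-i\omega)^k\prod_{j=1}^k\sqrt{d_j}},\qquad u_k^{\mathcal{L}}(x)=\frac{(-1)^k\mathcal{L}_k(x)}{(x+i\omega)^k\prod_{j=1}^k\sqrt{d_j}}.$$ Let $\ell_0=0$, $m_i=\sqrt{\rho_i-\ell_i^2}$ $(0\le i\le n-1)$ and $\ell_i=\sqrt{d_i}/m_{i-1}$ $(1\le i\le n-1)$; these are the diagonal and subdiagonal entries of the Cholesky factor $\mathcal{C}_n$ in $\mathcal{J}_n=\mathcal{C}_n\mathcal{C}_n^T$, where $\mathcal{J}_n$ is the (positive definite) symmetric tridiagonal $n\times n$ matrix with diagonal $\rho_0,\ldots,\rho_{n-1}$ and off-diagonal entries $\sqrt{d_1},\ldots,\sqrt{d_{n-1}}$. Define, for $\bullet\in\{\mathcal{L},\mathcal{R}\}$, $$\chi_i^{\bullet}(x)=m_iu_i^{\bullet}(x)+\ell_{i+1}u_{i+1}^{\bullet}(x)\ (0\le i\le n-2),\qquad \chi_{n-1}^{\bullet}(x)=m_{n-1}u_{n-1}^{\bullet}(x).$$ *)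

theory Defs
  imports "HOL-Complex_Analysis.Complex_Analysis"
begin

text \<open>Only the entries with index at least 1 are constrained; \<open>d 0\<close> is a free auxiliary constant.\<close>

definition positive_chain_sequence :: "(nat \<Rightarrow> real) \<Rightarrow> bool" where
  "positive_chain_sequence d \<longleftrightarrow>
     (\<exists>\<xi>. 0 \<le> \<xi> 0 \<and> \<xi> 0 < 1 \<and> (\<forall>n\<ge>1. 0 < \<xi> n \<and> \<xi> n < 1) \<and>
          (\<forall>n\<ge>1. d n = (1 - \<xi> (n - 1)) * \<xi> n))"

fun RII_poly ::
    "real \<Rightarrow> (nat \<Rightarrow> real) \<Rightarrow> (nat \<Rightarrow> real) \<Rightarrow> (nat \<Rightarrow> real) \<Rightarrow> nat \<Rightarrow> real poly" where
  "RII_poly \<omega> \<rho> c d 0 = 1"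
| "RII_poly \<omega> \<rho> c d (Suc 0) = smult (\<rho> 0) [:- c 0, 1:]"
| "RII_poly \<omega> \<rho> c d (Suc (Suc n)) =
     smult (\<rho> (Suc n)) [:- c (Suc n), 1:] * RII_poly \<omega> \<rho> c d (Suc n)
     - smult (d (Suc n)) [:\<omega>\<^sup>2, 0, 1:] * RII_poly \<omega> \<rho> c d n"

text \<open>The first equation is the convention that the polynomial of index \<open>-1\<close> is zero.\<close>

fun L_poly ::
    "real \<Rightarrow> (nat \<Rightarrow> real) \<Rightarrow> (nat \<Rightarrow> real) \<Rightarrow> (nat \<Rightarrow> real) \<Rightarrow> (nat \<Rightarrow> real) \<Rightarrow> nat \<Rightarrow> real poly" where
  "L_poly \<omega> \<rho> c d \<alpha> 0 = RII_poly \<omega> \<rho> c d 0"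
| "L_poly \<omega> \<rho> c d \<alpha> (Suc n) =
     RII_poly \<omega> \<rho> c d (Suc n) - smult (\<alpha> (Suc n)) (RII_poly \<omega> \<rho> c d n)"

definition L_cpoly ::
    "real \<Rightarrow> (nat \<Rightarrow> real) \<Rightarrow> (nat \<Rightarrow> real) \<Rightarrow> (nat \<Rightarrow> real) \<Rightarrow> (nat \<Rightarrow> real) \<Rightarrow> nat \<Rightarrow> complex poly" where
  "L_cpoly \<omega> \<rho> c d \<alpha> n = map_poly complex_of_real (L_poly \<omega> \<rho> c d \<alpha> n)"

definition u_R ::
    "real \<Rightarrow> (nat \<Rightarrow> real) \<Rightarrow> (nat \<Rightarrow> real) \<Rightarrow> (nat \<Rightarrow> real) \<Rightarrow> (nat \<Rightarrow> real)
      \<Rightarrow> nat \<Rightarrow> complex \<Rightarrow> complex" where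
  "u_R \<omega> \<rho> c d \<alpha> k z = (-1) ^ k * poly (L_cpoly \<omega> \<rho> c d \<alpha> k) z /
     ((z - \<i> * of_real \<omega>) ^ k * (\<Prod>j=1..k. of_real (sqrt (d j))))"

definition u_L ::
    "real \<Rightarrow> (nat \<Rightarrow> real) \<Rightarrow> (nat \<Rightarrow> real) \<Rightarrow> (nat \<Rightarrow> real) \<Rightarrow> (nat \<Rightarrow> real)
      \<Rightarrow> nat \<Rightarrow> complex \<Rightarrow> complex" where
  "u_L \<omega> \<rho> c d \<alpha> k z = (-1) ^ k * poly (L_cpoly \<omega> \<rho> c d \<alpha> k) z /
     ((z + \<i> * of_real \<omega>) ^ k * (\<Prod>j=1..k. of_real (sqrt (d j))))"

text \<open>
  Subdiagonal entries \<open>l\<close> and diagonal entries \<open>m\<close> of the Cholesky factor of the symmetric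
  tridiagonal matrix with diagonal \<open>\<rho>\<close> and off-diagonal entries \<open>sqrt (d 1), sqrt (d 2), \<dots>\<close>.
  They do not depend on the size of the matrix. In the recursion for \<open>l\<close>, the denominator is
  \<open>m i\<close> written out.
\<close>

fun chol_l :: "(nat \<Rightarrow> real) \<Rightarrow> (nat \<Rightarrow> real) \<Rightarrow> nat \<Rightarrow> real" where
  "chol_l \<rho> d 0 = 0"
| "chol_l \<rho> d (Suc i) = sqrt (d (Suc i)) / sqrt (\<rho> i - (chol_l \<rho> d i)\<^sup>2)"

definition chol_m :: "(nat \<Rightarrow> real) \<Rightarrow> (nat \<Rightarrow> real) \<Rightarrow> nat \<Rightarrow> real" where
  "chol_m \<rho> d i = sqrt (\<rho> i - (chol_l \<rho> d i)\<^sup>2)"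

text \<open>Meaningful for \<open>i < n\<close>; the last case is \<open>i = n - 1\<close>.\<close>

definition chi ::
    "(nat \<Rightarrow> real) \<Rightarrow> (nat \<Rightarrow> real) \<Rightarrow> nat \<Rightarrow> (nat \<Rightarrow> complex \<Rightarrow> complex) \<Rightarrow> nat
      \<Rightarrow> complex \<Rightarrow> complex" where
  "chi \<rho> d n u i z =
     (if i + 1 < n
      then of_real (chol_m \<rho> d i) * u i z + of_real (chol_l \<rho> d (i + 1)) * u (i + 1) z
      else of_real (chol_m \<rho> d i) * u i z)"

definition weight_recip ::
    "real \<Rightarrow> (nat \<Rightarrow> real) \<Rightarrow> (nat \<Rightarrow> real) \<Rightarrow> (nat \<Rightarrow> real) \<Rightarrow> (nat \<Rightarrow> real)
      \<Rightarrow> (nat \<Rightarrow> complex) \<Rightarrow> nat \<Rightarrow> nat \<Rightarrow> nat \<Rightarrow> complex" where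
  "weight_recip \<omega> \<rho> c d \<alpha> x n j k =
     - of_real (sqrt (d n)) * (x k - \<i> * of_real \<omega>)
       * deriv (u_R \<omega> \<rho> c d \<alpha> n) (x k) * u_L \<omega> \<rho> c d \<alpha> (n - 1) (x j)"

definition weight ::
    "real \<Rightarrow> (nat \<Rightarrow> real) \<Rightarrow> (nat \<Rightarrow> real) \<Rightarrow> (nat \<Rightarrow> real) \<Rightarrow> (nat \<Rightarrow> real)
      \<Rightarrow> (nat \<Rightarrow> complex) \<Rightarrow> nat \<Rightarrow> nat \<Rightarrow> nat \<Rightarrow> complex" where
  "weight \<omega> \<rho> c d \<alpha> x n j k = inverse (weight_recip \<omega> \<rho> c d \<alpha> x n j k)"

end

theory Submission imports Defs begin

text \<open>
  The sum over the functions \<open>\<chi>\<^sub>i\<close> is a bilinear form: since \<open>\<J>\<^sub>n = \<C>\<^sub>n \<C>\<^sub>n\<^sup>T\<close>, the sum of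
  \<open>\<chi>\<^sub>i\<^sup>L(y) \<chi>\<^sub>i\<^sup>R(z)\<close> is \<open>S(y, z) = u\<^sup>L(y)\<^sup>T \<J>\<^sub>n u\<^sup>R(z)\<close>. The conditions on \<open>\<alpha>\<^sub>n\<close> make
  the polynomials \<open>\<L>\<^sub>n\<close> satisfy a three-term recurrence of the same type as the \<open>\<P>\<^sub>n\<close>. Divided by
  powers of \<open>x \<mp> \<i>\<omega>\<close> it says that \<open>u\<^sup>R(z)\<close> solves \<open>z \<J>\<^sub>n u = T u\<close> up to a term in the last entry,
  with a Hermitian tridiagonal matrix \<open>T\<close>, and that \<open>u\<^sup>L\<close> solves the transposed equation. Hence
  there is a Christoffel-Darboux formula (\<open>chi_sum_christoffel_darboux\<close>)
  \<open>(y - z) S(y, z) = \<surd>d\<^sub>n ((z - \<i>\<omega>) u\<^sub>n\<^sup>R(z) u\<^bsub>n-1\<^esub>\<^sup>L(y) - (y + \<i>\<omega>) u\<^sub>n\<^sup>L(y) u\<^bsub>n-1\<^esub>\<^sup>R(z))\<close>.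

  At two distinct zeros of \<open>\<L>\<^sub>n\<close> the right-hand side vanishes, which gives orthogonality. At a
  single zero \<open>y\<close>, comparing the derivatives with respect to \<open>z\<close> of both sides at \<open>z = y\<close> shows that
  \<open>S(y, y)\<close> is the reciprocal weight (\<open>chi_sum_diagonal\<close>).

  It remains to see that the zeros are simple, since they are only given with multiplicity, and
  that the weights are well defined. The polynomial \<open>\<L>\<^sub>n\<close> does not vanish at the points \<open>\<plusminus> \<i>\<omega>\<close>
  (\<open>Lc_nonzero_at_pole\<close>). The chain sequence makes \<open>\<J>\<^sub>n\<close> positive definite (\<open>chol_pivot_pos\<close>), so
  that \<open>S\<close> at the pair of the conjugate of \<open>z\<close> and \<open>z\<close> is a positive sum of squared moduli. If \<open>z\<close> is a
  zero, then so is its conjugate, and the Christoffel-Darboux formula for this pair forces \<open>z\<close> to be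
  real. Then \<open>S(z, z) \<noteq> 0\<close>, so no factor of the reciprocal weight at \<open>z\<close> vanishes; in particular
  the derivative of \<open>u\<^sub>n\<^sup>R\<close> does not, and the zero is simple.
\<close>

section \<open>Evaluation of real polynomials at complex points\<close>

lemma map_poly_of_real_diff:
  "map_poly complex_of_real (p - q) = map_poly complex_of_real p - map_poly complex_of_real q"
  by (intro poly_eqI) (simp add: coeff_map_poly)

lemma map_poly_of_real_add:
  "map_poly complex_of_real (p + q) = map_poly complex_of_real p + map_poly complex_of_real q"
  by (intro poly_eqI) (simp add: coeff_map_poly)

lemma map_poly_of_real_smult:
  "map_poly complex_of_real (smult a p) = smult (complex_of_real a) (map_poly complex_of_real p)"
  by (intro poly_eqI) (simp add: coeff_map_poly)

lemmas map_poly_of_real_simps =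
  map_poly_of_real_diff map_poly_of_real_add map_poly_of_real_smult map_poly_pCons

section \<open>The sums of products of the functions \<open>\<chi>\<^sub>i\<close>\<close>

text \<open>The value at the pair of vectors \<open>V\<close>, \<open>U\<close> of the bilinear form with the symmetric tridiagonal
  matrix of order \<open>Suc m\<close> that has diagonal entries \<open>r\<^sub>i\<close> and off-diagonal entries \<open>b\<^sub>i\<close>.\<close>

definition tridiag_form ::
    "(nat \<Rightarrow> complex) \<Rightarrow> (nat \<Rightarrow> complex) \<Rightarrow> (nat \<Rightarrow> complex) \<Rightarrow> (nat \<Rightarrow> complex) \<Rightarrow> nat \<Rightarrow> complex" where
  "tridiag_form r b V U m =
     (\<Sum>i\<le>m. r i * V i * U i) + (\<Sum>i<m. b (Suc i) * (V i * U (Suc i) + V (Suc i) * U i))"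

text \<open>The Christoffel-Darboux formula. The hypotheses say that \<open>z\<close> times the matrix of
  \<open>tridiag_form\<close>, applied to \<open>U\<close>, equals \<open>T U\<close> except in the last entry, where \<open>T\<close> is tridiagonal
  with diagonal entries \<open>t\<^sub>i\<close>, entries \<open>e b\<^sub>i\<close> above and \<open>- e b\<^sub>i\<close> below the diagonal; and the same
  for \<open>y\<close>, \<open>V\<close> and the transpose of \<open>T\<close>. In the difference only the corrections of the last entries
  remain.\<close>

lemma tridiag_christoffel_darboux:
  fixes r b t U V :: "nat \<Rightarrow> complex" and e y z :: complex
  assumes U0: "(z - e) * b 1 * U 1 = - (r 0 * z - t 0) * U 0"
    and V0: "(y + e) * b 1 * V 1 = - (r 0 * y - t 0) * V 0"
    and U: "\<And>k. (z - e) * b (Suc (Suc k)) * U (Suc (Suc k)) =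
              - (r (Suc k) * z - t (Suc k)) * U (Suc k) - b (Suc k) * (z + e) * U k"
    and V: "\<And>k. (y + e) * b (Suc (Suc k)) * V (Suc (Suc k)) =
              - (r (Suc k) * y - t (Suc k)) * V (Suc k) - b (Suc k) * (y - e) * V k"
  shows "(y - z) * tridiag_form r b V U m =
           b (Suc m) * ((z - e) * U (Suc m) * V m - (y + e) * V (Suc m) * U m)"
proof (induction m)
  case 0
  have "b 1 * ((z - e) * U 1 * V 0 - (y + e) * V 1 * U 0)
      = ((z - e) * b 1 * U 1) * V 0 - ((y + e) * b 1 * V 1) * U 0"
    by (simp add: algebra_simps)
  also have "\<dots> = (y - z) * (r 0 * V 0 * U 0)"
    unfolding U0 V0 by (simp add: algebra_simps)
  finally show ?case by (simp add: tridiag_form_def)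
next
  case (Suc m)
  have "b (Suc (Suc m)) * ((z - e) * U (Suc (Suc m)) * V (Suc m) - (y + e) * V (Suc (Suc m)) * U (Suc m))
      = ((z - e) * b (Suc (Suc m)) * U (Suc (Suc m))) * V (Suc m)
        - ((y + e) * b (Suc (Suc m)) * V (Suc (Suc m))) * U (Suc m)"
    by (simp add: algebra_simps)
  also have "\<dots> = b (Suc m) * ((z - e) * U (Suc m) * V m - (y + e) * V (Suc m) * U m)
      + (y - z) * (r (Suc m) * V (Suc m) * U (Suc m)
                   + b (Suc m) * (V m * U (Suc m) + V (Suc m) * U m))"
    unfolding U V by (simp add: algebra_simps)
  also have "\<dots> = (y - z) * tridiag_form r b V U (Suc m)"
    unfolding Suc.IH[symmetric] by (simp add: tridiag_form_def algebra_simps)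
  finally show ?case by simp
qed

text \<open>The form splits along a Cholesky factorization of the matrix.\<close>

lemma tridiag_form_cholesky:
  fixes r b V U \<mu> \<nu> :: "nat \<Rightarrow> complex"
  assumes "(\<mu> 0)\<^sup>2 = r 0"
    and "\<And>i. (\<mu> (Suc i))\<^sup>2 + (\<nu> (Suc i))\<^sup>2 = r (Suc i)"
    and "\<And>i. \<mu> i * \<nu> (Suc i) = b (Suc i)"
  shows "(\<Sum>i<m. (\<mu> i * V i + \<nu> (Suc i) * V (Suc i)) * (\<mu> i * U i + \<nu> (Suc i) * U (Suc i)))
           + \<mu> m * V m * (\<mu> m * U m) = tridiag_form r b V U m"
proof (induction m)
  case 0
  then show ?case by (simp add: tridiag_form_def assms(1)[symmetric] power2_eq_square)
next
  case (Suc m)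
  have "tridiag_form r b V U (Suc m) = tridiag_form r b V U m
     + r (Suc m) * V (Suc m) * U (Suc m) + b (Suc m) * (V m * U (Suc m) + V (Suc m) * U m)"
    by (simp add: tridiag_form_def)
  then show ?case
    unfolding Suc.IH[symmetric] assms(2)[symmetric] assms(3)[symmetric]
    by (simp add: algebra_simps power2_eq_square)
qed

lemma sum_chi_mult:
  assumes "n \<ge> 1"
  shows "(\<Sum>i=0..n-1. chi \<rho> d n v i y * chi \<rho> d n u i z) =
    (\<Sum>i<n-1. (of_real (chol_m \<rho> d i) * v i y + of_real (chol_l \<rho> d (Suc i)) * v (Suc i) y)
            * (of_real (chol_m \<rho> d i) * u i z + of_real (chol_l \<rho> d (Suc i)) * u (Suc i) z))
    + of_real (chol_m \<rho> d (n-1)) * v (n-1) y * (of_real (chol_m \<rho> d (n-1)) * u (n-1) z)"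
proof -
  obtain m where n: "n = Suc m" using assms by (cases n) auto
  have "{0..m} = insert m {..<m}" by auto
  then show ?thesis by (simp add: n chi_def)
qed

section \<open>Positive definiteness of the tridiagonal matrix\<close>

lemma positive_chain_sequence_pos:
  assumes "positive_chain_sequence d" "k \<ge> 1"
  shows "d k > 0"
proof -
  from assms obtain \<xi> where \<xi>: "\<xi> 0 < 1" "\<forall>n\<ge>1. 0 < \<xi> n \<and> \<xi> n < 1"
    "\<forall>n\<ge>1. d n = (1 - \<xi> (n - 1)) * \<xi> n"
    unfolding positive_chain_sequence_def by blast
  have "\<xi> (k - 1) < 1" using \<xi> by (cases "k - 1") auto
  then show ?thesis using \<xi> assms(2) by simp
qed

text \<open>The parameters of a chain sequence bound the Cholesky factor: \<open>\<ell>\<^sub>i\<^sup>2 \<le> \<xi>\<^sub>i\<close> by induction, since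
  \<open>m\<^sub>i\<^sup>2 = \<rho>\<^sub>i - \<ell>\<^sub>i\<^sup>2 \<ge> 1 - \<xi>\<^sub>i\<close>.\<close>

lemma chol_pivot_pos:
  assumes "positive_chain_sequence d" and \<rho>: "\<And>k. \<rho> k \<ge> 1"
  shows "\<rho> i - (chol_l \<rho> d i)\<^sup>2 > 0"
proof -
  from assms obtain \<xi> where \<xi>: "0 \<le> \<xi> 0" "\<xi> 0 < 1" "\<forall>n\<ge>1. 0 < \<xi> n \<and> \<xi> n < 1"
    "\<forall>n\<ge>1. d n = (1 - \<xi> (n - 1)) * \<xi> n"
    unfolding positive_chain_sequence_def by blast
  have lt: "\<xi> i < 1" for i using \<xi> by (cases i) auto
  have "(chol_l \<rho> d i)\<^sup>2 \<le> \<xi> i"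
  proof (induction i)
    case 0
    then show ?case using \<xi> by simp
  next
    case (Suc i)
    have piv: "\<rho> i - (chol_l \<rho> d i)\<^sup>2 \<ge> 1 - \<xi> i" using Suc \<rho>[of i] by linarith
    moreover have "1 - \<xi> i > 0" using lt[of i] by simp
    moreover have "d (Suc i) = (1 - \<xi> i) * \<xi> (Suc i)" "\<xi> (Suc i) > 0" using \<xi> by auto
    ultimately have "(chol_l \<rho> d (Suc i))\<^sup>2 = d (Suc i) / (\<rho> i - (chol_l \<rho> d i)\<^sup>2)"
      by (simp add: power_divide)
    also have "\<dots> \<le> d (Suc i) / (1 - \<xi> i)"
      using piv \<open>1 - \<xi> i > 0\<close> positive_chain_sequence_pos[OF assms(1), of "Suc i"]
      by (intro divide_left_mono) auto
    also have "\<dots> = \<xi> (Suc i)"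
      using \<open>d (Suc i) = _\<close> \<open>1 - \<xi> i > 0\<close> by simp
    finally show ?case .
  qed
  then show ?thesis using lt[of i] \<rho>[of i] by linarith
qed

section \<open>The polynomials and the rational functions\<close>

text \<open>The parameters of the polynomials \<open>\<P>\<^sub>n\<close> and \<open>\<L>\<^sub>n\<close>. The auxiliary constant \<open>d 0\<close> is not
  assumed to be nonzero; this follows from \<open>\<alpha>_ratio\<close> at 1.\<close>

locale RII_quasi_orthogonal =
  fixes \<omega> :: real and \<rho> c d \<alpha> :: "nat \<Rightarrow> real"
  assumes \<omega>_nonzero: "\<omega> \<noteq> 0"
    and \<rho>_ge_1: "\<And>k. \<rho> k \<ge> 1"
    and chain: "positive_chain_sequence d"
    and \<alpha>_nonzero: "\<And>k. \<alpha> k \<noteq> 0"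
    and \<alpha>_rec: "\<And>k. k \<ge> 1 \<Longrightarrow>
          \<alpha> k = \<rho> (k - 1) * (1 - c (k - 1)) - \<omega>\<^sup>2 * inverse (\<alpha> (k - 1)) * d (k - 1)"
    and \<alpha>_ratio: "\<And>k. k \<ge> 1 \<Longrightarrow> d k * \<alpha> (k - 1) * \<rho> (k - 1) = d (k - 1) * \<alpha> k * \<rho> k"
begin

lemma \<rho>_pos: "\<rho> k > 0"
  using \<rho>_ge_1[of k] by linarith

lemma d_pos: "k \<ge> 1 \<Longrightarrow> d k > 0"
  using positive_chain_sequence_pos[OF chain] .

lemma d_nonzero: "d k \<noteq> 0"
proof (cases k)
  case 0
  have "d 1 * \<alpha> 0 * \<rho> 0 \<noteq> 0" using d_pos[of 1] \<alpha>_nonzero \<rho>_pos[of 0] by simp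
  then show ?thesis using \<alpha>_ratio[of 1] 0 by auto
qed (use d_pos[of k] in simp)

text \<open>The coefficients \<open>t\<^sub>n\<close> in \<open>\<L>\<^bsub>n+1\<^esub> = (\<rho>\<^sub>n x - t\<^sub>n) \<L>\<^sub>n - d\<^sub>n (x\<^sup>2 + \<omega>\<^sup>2) \<L>\<^bsub>n-1\<^esub>\<close>, in the simple
  form to which the two conditions on \<open>\<alpha>\<^sub>n\<close> reduce them; the value at 0 describes \<open>\<L>\<^sub>1\<close>.\<close>

fun L_shift :: "nat \<Rightarrow> real" where
  "L_shift 0 = \<rho> 0 * c 0 + \<alpha> 1"
| "L_shift (Suc m) = \<rho> (Suc m) * c m"

text \<open>When the recurrence for \<open>\<L>\<^sub>n\<close> is expressed through \<open>\<P>\<^sub>n\<close> and \<open>\<P>\<^bsub>n-1\<^esub>\<close>, the coefficients of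
  these two polynomials prescribe \<open>t\<^sub>n\<close> in two ways; the conditions on \<open>\<alpha>\<^sub>n\<close> make them agree.\<close>

lemma L_shift_eq:
  "L_shift (Suc m) = \<rho> (Suc m) * c (Suc m) + \<alpha> (Suc (Suc m)) - d (Suc m) * \<alpha> m / d m"
proof -
  have 1: "\<alpha> (Suc m) = \<rho> m * (1 - c m) - \<omega>\<^sup>2 * inverse (\<alpha> m) * d m"
    using \<alpha>_rec[of "Suc m"] by simp
  have 2: "\<alpha> (Suc (Suc m)) = \<rho> (Suc m) * (1 - c (Suc m)) - \<omega>\<^sup>2 * inverse (\<alpha> (Suc m)) * d (Suc m)"
    using \<alpha>_rec[of "Suc (Suc m)"] by simp
  have 3: "d (Suc m) * \<alpha> m * \<rho> m = d m * \<alpha> (Suc m) * \<rho> (Suc m)"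
    using \<alpha>_ratio[of "Suc m"] by simp
  have nz: "\<alpha> m \<noteq> 0" "\<alpha> (Suc m) \<noteq> 0" "d m \<noteq> 0" "\<rho> m \<noteq> 0"
    using \<alpha>_nonzero d_nonzero \<rho>_pos[of m] by auto
  have R: "\<rho> (Suc m) = d (Suc m) * \<alpha> m * \<rho> m / (d m * \<alpha> (Suc m))"
    using 3 nz by (simp add: field_simps)
  have "\<rho> (Suc m) * (1 - c m) = d (Suc m) * \<alpha> m / (d m * \<alpha> (Suc m)) * (\<rho> m * (1 - c m))"
    unfolding R by simp
  also have "\<rho> m * (1 - c m) = \<alpha> (Suc m) + \<omega>\<^sup>2 * inverse (\<alpha> m) * d m"
    using 1 by simp
  also have "d (Suc m) * \<alpha> m / (d m * \<alpha> (Suc m)) * (\<alpha> (Suc m) + \<omega>\<^sup>2 * inverse (\<alpha> m) * d m)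
      = d (Suc m) * \<alpha> m / d m + \<omega>\<^sup>2 * inverse (\<alpha> (Suc m)) * d (Suc m)"
    using nz by (simp add: field_simps)
  finally show ?thesis using 2 by (simp add: algebra_simps)
qed

text \<open>The values at complex points of \<open>\<L>\<^sub>k\<close> and \<open>\<P>\<^sub>k\<close>.\<close>

abbreviation Lc :: "nat \<Rightarrow> complex \<Rightarrow> complex" where
  "Lc k z \<equiv> poly (L_cpoly \<omega> \<rho> c d \<alpha> k) z"

abbreviation Pc :: "nat \<Rightarrow> complex \<Rightarrow> complex" where
  "Pc k z \<equiv> poly (map_poly complex_of_real (RII_poly \<omega> \<rho> c d k)) z"

lemma Pc_rec:
  "Pc (Suc (Suc k)) z = of_real (\<rho> (Suc k)) * (z - of_real (c (Suc k))) * Pc (Suc k) z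
     - of_real (d (Suc k)) * (z\<^sup>2 + (of_real \<omega>)\<^sup>2) * Pc k z"
  by (simp add: map_poly_of_real_simps algebra_simps power2_eq_square)

lemma Lc_0: "Lc 0 z = 1"
  by (simp add: L_cpoly_def)

lemma Lc_Suc: "Lc (Suc k) z = Pc (Suc k) z - of_real (\<alpha> (Suc k)) * Pc k z"
  by (simp add: L_cpoly_def map_poly_of_real_simps)

lemma Lc_1: "Lc (Suc 0) z = of_real (\<rho> 0) * z - of_real (L_shift 0)"
  by (simp add: L_cpoly_def map_poly_of_real_simps algebra_simps)

lemma Lc_rec:
  "Lc (Suc (Suc m)) z = (of_real (\<rho> (Suc m)) * z - of_real (L_shift (Suc m))) * Lc (Suc m) z
     - of_real (d (Suc m)) * (z\<^sup>2 + (of_real \<omega>)\<^sup>2) * Lc m z"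
proof -
  define q where "q = complex_of_real (d (Suc m) * \<alpha> m / d m)"
  have "complex_of_real (L_shift (Suc m))
      = of_real (\<rho> (Suc m)) * of_real (c (Suc m)) + of_real (\<alpha> (Suc (Suc m))) - q"
    unfolding L_shift_eq q_def by simp
  then have shift: "of_real (L_shift (Suc m)) - of_real (\<rho> (Suc m)) * of_real (c (Suc m))
      - of_real (\<alpha> (Suc (Suc m))) = - q"
    by simp
  have "d (Suc m) * \<alpha> m / d m * \<rho> m = \<alpha> (Suc m) * \<rho> (Suc m)"
    using \<alpha>_ratio[of "Suc m"] d_nonzero[of m] by (simp add: field_simps)
  then have q: "q * of_real (\<rho> m) = of_real (\<alpha> (Suc m)) * of_real (\<rho> (Suc m))"
    unfolding q_def by (metis of_real_mult)
  have q': "q * of_real (d m) = of_real (d (Suc m)) * of_real (\<alpha> m)"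
    using d_nonzero[of m] by (simp add: q_def)
  \<comment> \<open>\<open>Q\<close> is the preceding polynomial \<open>\<P>\<close> of index \<open>m - 1\<close>, which is zero for \<open>m = 0\<close>.\<close>
  obtain Q where P: "Pc (Suc m) z = of_real (\<rho> m) * (z - of_real (c m)) * Pc m z
        - of_real (d m) * (z\<^sup>2 + (of_real \<omega>)\<^sup>2) * Q"
    and L: "Lc m z = Pc m z - of_real (\<alpha> m) * Q"
  proof (cases m)
    case 0
    show ?thesis
      by (rule that[of 0]) (simp_all add: 0 Lc_0 map_poly_of_real_simps algebra_simps)
  next
    case (Suc k)
    show ?thesis unfolding Suc by (rule that[unfolded Suc, OF Pc_rec Lc_Suc])
  qed
  have "Lc (Suc (Suc m)) z
      - (of_real (\<rho> (Suc m)) * z - of_real (L_shift (Suc m))) * Lc (Suc m) z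
      + of_real (d (Suc m)) * (z\<^sup>2 + (of_real \<omega>)\<^sup>2) * Lc m z
    = (of_real (L_shift (Suc m)) - of_real (\<rho> (Suc m)) * of_real (c (Suc m))
         - of_real (\<alpha> (Suc (Suc m)))) * Pc (Suc m) z
      + of_real (\<alpha> (Suc m)) * (of_real (\<rho> (Suc m)) * z - of_real (L_shift (Suc m))) * Pc m z
      - of_real (d (Suc m)) * of_real (\<alpha> m) * (z\<^sup>2 + (of_real \<omega>)\<^sup>2) * Q"
    unfolding Lc_Suc Pc_rec L by (simp add: algebra_simps)
  also have "\<dots> = (of_real (\<alpha> (Suc m)) * of_real (\<rho> (Suc m)) - q * of_real (\<rho> m))
        * (z - of_real (c m)) * Pc m z
      + (q * of_real (d m) - of_real (d (Suc m)) * of_real (\<alpha> m)) * (z\<^sup>2 + (of_real \<omega>)\<^sup>2) * Q"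
    unfolding shift P by (simp add: algebra_simps)
  finally show ?thesis unfolding q q' by (simp add: algebra_simps)
qed

text \<open>At the possible poles \<open>\<plusminus> \<i>\<omega>\<close> the recurrence has only one term, and its factor has a nonzero
  imaginary part.\<close>

lemma Lc_nonzero_at_pole:
  assumes "z\<^sup>2 + (of_real \<omega>)\<^sup>2 = 0"
  shows "Lc k z \<noteq> 0"
proof -
  have "(z - \<i> * of_real \<omega>) * (z + \<i> * of_real \<omega>) = z\<^sup>2 + (of_real \<omega>)\<^sup>2"
    by (simp add: algebra_simps power2_eq_square)
  then have "z - \<i> * of_real \<omega> = 0 \<or> z + \<i> * of_real \<omega> = 0"
    using assms by (metis mult_eq_0_iff)
  then have "Im z = \<omega> \<or> Im z = - \<omega>"
    by (auto simp: complex_eq_iff)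
  then have "Im z \<noteq> 0" using \<omega>_nonzero by auto
  have fac: "of_real (\<rho> k) * z - of_real r \<noteq> 0" for k r
    using \<open>Im z \<noteq> 0\<close> \<rho>_pos[of k] by (auto simp: complex_eq_iff)
  have step: "Lc (Suc k) z = (of_real (\<rho> k) * z - of_real (L_shift k)) * Lc k z" for k
  proof (cases k)
    case 0
    then show ?thesis by (simp only: Lc_1 Lc_0 mult_1_right)
  next
    case (Suc m)
    show ?thesis unfolding Suc Lc_rec assms by simp
  qed
  show ?thesis
    by (induction k) (simp add: Lc_0, simp only: step, use fac in simp)
qed

lemma Lc_cnj: "Lc k (cnj z) = cnj (Lc k z)"
  by (subst poly_cnj_real) (simp_all add: L_cpoly_def coeff_map_poly)

text \<open>The common form of the two families of rational functions, with \<open>e = \<i>\<omega>\<close> for \<open>u\<^sup>R\<close> and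
  \<open>e = - \<i>\<omega>\<close> for \<open>u\<^sup>L\<close>.\<close>

definition ratu :: "complex \<Rightarrow> nat \<Rightarrow> complex \<Rightarrow> complex" where
  "ratu e k z = (-1) ^ k * Lc k z / ((z - e) ^ k * (\<Prod>j=1..k. of_real (sqrt (d j))))"

lemma u_R_eq_ratu: "u_R \<omega> \<rho> c d \<alpha> = ratu (\<i> * of_real \<omega>)"
  by (intro ext) (simp add: u_R_def ratu_def)

lemma u_L_eq_ratu: "u_L \<omega> \<rho> c d \<alpha> = ratu (- (\<i> * of_real \<omega>))"
  by (intro ext) (simp add: u_L_def ratu_def)

lemma ratu_0: "ratu e 0 z = 1"
  by (simp add: ratu_def Lc_0)

lemma prod_sqrt_d_nonzero: "(\<Prod>j=1..k. complex_of_real (sqrt (d j))) \<noteq> 0"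
  using d_pos by (subst prod_zero_iff) force+

lemma prod_sqrt_d_Suc:
  "(\<Prod>j=1..Suc k. complex_of_real (sqrt (d j))) =
     of_real (sqrt (d (Suc k))) * (\<Prod>j=1..k. of_real (sqrt (d j)))"
  by (simp add: mult.commute)

lemma ratu_rec_0:
  assumes "z \<noteq> e"
  shows "(z - e) * of_real (sqrt (d 1)) * ratu e 1 z
     = - (of_real (\<rho> 0) * z - of_real (L_shift 0)) * ratu e 0 z"
proof -
  have nz: "complex_of_real (sqrt (d 1)) \<noteq> 0" using d_pos[of 1] by simp
  have "ratu e 1 z = - (of_real (\<rho> 0) * z - of_real (L_shift 0)) / ((z - e) * of_real (sqrt (d 1)))"
    unfolding ratu_def One_nat_def Lc_1 by simp
  then show ?thesis
    using assms nz by (simp add: ratu_0)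
qed

lemma ratu_rec:
  assumes "z \<noteq> e" and e: "e\<^sup>2 = - (of_real \<omega>)\<^sup>2"
  shows "(z - e) * of_real (sqrt (d (Suc (Suc k)))) * ratu e (Suc (Suc k)) z
     = - (of_real (\<rho> (Suc k)) * z - of_real (L_shift (Suc k))) * ratu e (Suc k) z
       - of_real (sqrt (d (Suc k))) * (z + e) * ratu e k z"
proof -
  define b where "b k = complex_of_real (sqrt (d k))" for k
  define D where "D = (\<Prod>j=1..k. b j)"
  have nz: "b (Suc k) \<noteq> 0" "b (Suc (Suc k)) \<noteq> 0" "D \<noteq> 0" "z - e \<noteq> 0"
    using d_pos[of "Suc k"] d_pos[of "Suc (Suc k)"] prod_sqrt_d_nonzero[of k] assms(1)
    by (simp_all add: b_def D_def)
  have sq: "of_real (d (Suc k)) = b (Suc k) * b (Suc k)"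
    using d_pos[of "Suc k"] by (simp add: b_def flip: of_real_mult)
  have fac: "z\<^sup>2 + (of_real \<omega>)\<^sup>2 = (z - e) * (z + e)"
    using e by (simp add: algebra_simps power2_eq_square)
  define A where "A = of_real (\<rho> (Suc k)) * z - complex_of_real (L_shift (Suc k))"
  have u0: "ratu e k z = (-1) ^ k * Lc k z / ((z - e) ^ k * D)"
    by (simp add: ratu_def D_def b_def)
  have u1: "ratu e (Suc k) z = - ((-1) ^ k * Lc (Suc k) z / ((z - e) * (z - e) ^ k * (b (Suc k) * D)))"
    unfolding ratu_def prod_sqrt_d_Suc by (simp add: D_def b_def)
  have u2: "ratu e (Suc (Suc k)) z = (-1) ^ k * (A * Lc (Suc k) z - b (Suc k) * b (Suc k) * ((z - e) * (z + e)) * Lc k z)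
      / ((z - e) * ((z - e) * (z - e) ^ k) * (b (Suc (Suc k)) * (b (Suc k) * D)))"
    unfolding ratu_def prod_sqrt_d_Suc Lc_rec sq fac by (simp add: D_def b_def A_def)
  show ?thesis
    unfolding A_def[symmetric] b_def[symmetric] u0 u1 u2 using nz
    by (simp add: divide_simps) (simp add: algebra_simps)
qed

text \<open>The sum in the biorthogonality relation of order \<open>n\<close>.\<close>

definition chi_sum :: "nat \<Rightarrow> complex \<Rightarrow> complex \<Rightarrow> complex" where
  "chi_sum n y z = (\<Sum>i=0..n-1. chi \<rho> d n (u_L \<omega> \<rho> c d \<alpha>) i y * chi \<rho> d n (u_R \<omega> \<rho> c d \<alpha>) i z)"

lemma pivot_pos: "\<rho> i - (chol_l \<rho> d i)\<^sup>2 > 0"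
  using chain \<rho>_ge_1 by (rule chol_pivot_pos)

lemma chol_m_pos: "chol_m \<rho> d i > 0"
  using pivot_pos by (simp add: chol_m_def)

lemma chi_sum_eq_tridiag_form:
  assumes "n \<ge> 1"
  shows "chi_sum n y z =
    tridiag_form (\<lambda>i. of_real (\<rho> i)) (\<lambda>i. of_real (sqrt (d i)))
      (\<lambda>i. u_L \<omega> \<rho> c d \<alpha> i y) (\<lambda>i. u_R \<omega> \<rho> c d \<alpha> i z) (n - 1)"
proof -
  have m2: "(chol_m \<rho> d i)\<^sup>2 + (chol_l \<rho> d i)\<^sup>2 = \<rho> i" for i
    using pivot_pos[of i] by (simp add: chol_m_def)
  have ml: "chol_m \<rho> d i * chol_l \<rho> d (Suc i) = sqrt (d (Suc i))" for i
    using chol_m_pos[of i] by (simp add: chol_m_def)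
  show ?thesis
    unfolding chi_sum_def sum_chi_mult[OF assms]
  proof (rule tridiag_form_cholesky)
    show "(complex_of_real (chol_m \<rho> d 0))\<^sup>2 = of_real (\<rho> 0)"
      using m2[of 0] by (simp flip: of_real_power)
    show "(complex_of_real (chol_m \<rho> d (Suc i)))\<^sup>2 + (complex_of_real (chol_l \<rho> d (Suc i)))\<^sup>2
        = of_real (\<rho> (Suc i))" for i
      using m2[of "Suc i"] by (metis of_real_add of_real_power)
    show "complex_of_real (chol_m \<rho> d i) * of_real (chol_l \<rho> d (Suc i)) = of_real (sqrt (d (Suc i)))" for i
      using ml[of i] by (metis of_real_mult)
  qed
qed

lemma chi_sum_christoffel_darboux:
  assumes "n \<ge> 1" and y: "y \<noteq> - (\<i> * of_real \<omega>)" and z: "z \<noteq> \<i> * of_real \<omega>"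
  shows "(y - z) * chi_sum n y z = of_real (sqrt (d n)) *
    ((z - \<i> * of_real \<omega>) * u_R \<omega> \<rho> c d \<alpha> n z * u_L \<omega> \<rho> c d \<alpha> (n - 1) y
     - (y + \<i> * of_real \<omega>) * u_L \<omega> \<rho> c d \<alpha> n y * u_R \<omega> \<rho> c d \<alpha> (n - 1) z)"
proof -
  define e where "e = \<i> * complex_of_real \<omega>"
  have e2: "e\<^sup>2 = - (of_real \<omega>)\<^sup>2" "(- e)\<^sup>2 = - (of_real \<omega>)\<^sup>2"
    by (simp_all add: e_def power_mult_distrib)
  have "z \<noteq> e" "y \<noteq> - e" using y z by (simp_all add: e_def)
  obtain m where n: "n = Suc m" using assms by (cases n) auto
  show ?thesis
    unfolding chi_sum_eq_tridiag_form[OF assms(1)] unfolding n diff_Suc_1 u_R_eq_ratu u_L_eq_ratu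
      e_def[symmetric]
    by (rule tridiag_christoffel_darboux[where t = "\<lambda>i. of_real (L_shift i)"])
      (use ratu_rec_0[OF \<open>z \<noteq> e\<close>] ratu_rec_0[OF \<open>y \<noteq> - e\<close>]
        ratu_rec[OF \<open>z \<noteq> e\<close> e2(1)] ratu_rec[OF \<open>y \<noteq> - e\<close> e2(2)] in simp_all)
qed

section \<open>The zeros\<close>

lemma u_L_cnj: "u_L \<omega> \<rho> c d \<alpha> k (cnj z) = cnj (u_R \<omega> \<rho> c d \<alpha> k z)"
  by (simp add: u_L_def u_R_def Lc_cnj)

lemma chi_cnj: "chi \<rho> d n (u_L \<omega> \<rho> c d \<alpha>) i (cnj z) = cnj (chi \<rho> d n (u_R \<omega> \<rho> c d \<alpha>) i z)"
  by (simp add: chi_def u_L_cnj)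

text \<open>The sum is that of \<open>|\<chi>\<^sub>i\<^sup>R(z)|\<^sup>2\<close>, and not all \<open>\<chi>\<^sub>i\<^sup>R(z)\<close> vanish because \<open>u\<^sub>0\<^sup>R = 1\<close>.\<close>

lemma chi_sum_cnj_nonzero:
  assumes "n \<ge> 1"
  shows "chi_sum n (cnj z) z \<noteq> 0"
proof
  assume "chi_sum n (cnj z) z = 0"
  then have "(\<Sum>i=0..n-1. complex_of_real ((cmod (chi \<rho> d n (u_R \<omega> \<rho> c d \<alpha>) i z))\<^sup>2)) = 0"
    unfolding chi_sum_def chi_cnj complex_norm_square by (simp add: mult.commute)
  then have "(\<Sum>i=0..n-1. (cmod (chi \<rho> d n (u_R \<omega> \<rho> c d \<alpha>) i z))\<^sup>2) = 0"
    by (metis of_real_sum of_real_eq_0_iff)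
  then have chi0: "chi \<rho> d n (u_R \<omega> \<rho> c d \<alpha>) i z = 0" if "i < n" for i
    using that by (subst (asm) sum_nonneg_eq_0_iff) auto
  \<comment> \<open>The system is triangular and is solved backwards from the last entry.\<close>
  have "u_R \<omega> \<rho> c d \<alpha> (n - 1 - i) z = 0" if "i < n" for i
    using that
  proof (induction i)
    case 0
    then show ?case using chi0[of "n - 1"] chol_m_pos[of "n - 1"] by (simp add: chi_def)
  next
    case (Suc i)
    then have "Suc (n - 1 - Suc i) = n - 1 - i" by simp
    then show ?case
      using Suc chi0[of "n - 1 - Suc i"] chol_m_pos[of "n - 1 - Suc i"]
      by (simp add: chi_def split: if_splits)
  qed
  from this[of "n - 1"] show False
    using assms by (simp add: u_R_eq_ratu ratu_0)
qed

lemma zero_not_pole: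
  assumes "Lc n z = 0"
  shows "z \<noteq> \<i> * of_real \<omega>" "z \<noteq> - (\<i> * of_real \<omega>)"
  using assms Lc_nonzero_at_pole[of z n] by (auto simp: power_mult_distrib)

lemma zero_real:
  assumes "n \<ge> 1" "Lc n z = 0"
  shows "cnj z = z"
proof -
  have "Lc n (cnj z) = 0" using assms by (simp add: Lc_cnj)
  then have "(cnj z - z) * chi_sum n (cnj z) z = 0"
    using assms zero_not_pole[of n]
    by (subst chi_sum_christoffel_darboux) (auto simp: u_R_def u_L_def)
  then show ?thesis using chi_sum_cnj_nonzero[OF assms(1)] by simp
qed

lemma u_R_field_differentiable:
  assumes "z \<noteq> \<i> * of_real \<omega>"
  shows "u_R \<omega> \<rho> c d \<alpha> k field_differentiable at z"
proof -
  have "(\<lambda>z. u_R \<omega> \<rho> c d \<alpha> k z) field_differentiable at z"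
    unfolding u_R_def using assms prod_sqrt_d_nonzero[of k]
    by (intro derivative_intros)
       (auto intro!: derivative_intros simp: field_differentiable_def intro: poly_DERIV)
  then show ?thesis .
qed

text \<open>The confluent case of the Christoffel-Darboux formula: both sides are differentiated with
  respect to \<open>z\<close> at the zero \<open>y\<close>.\<close>

lemma chi_sum_diagonal:
  assumes "n \<ge> 1" "Lc n y = 0"
  shows "chi_sum n y y = - of_real (sqrt (d n)) * (y - \<i> * of_real \<omega>)
    * deriv (u_R \<omega> \<rho> c d \<alpha> n) y * u_L \<omega> \<rho> c d \<alpha> (n - 1) y"
proof -
  note y = zero_not_pole[OF assms(2)]
  let ?e = "\<i> * complex_of_real \<omega>"
  let ?K = "of_real (sqrt (d n)) * u_L \<omega> \<rho> c d \<alpha> (n - 1) y"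
  have uR: "u_R \<omega> \<rho> c d \<alpha> n y = 0" and uL: "u_L \<omega> \<rho> c d \<alpha> n y = 0"
    using assms by (simp_all add: u_R_def u_L_def)
  have "chi_sum n y field_differentiable at y"
  proof -
    have "(\<lambda>z. chi \<rho> d n (u_R \<omega> \<rho> c d \<alpha>) i z) field_differentiable at y" for i
      unfolding chi_def
      by (cases "i + 1 < n")
        (auto intro!: derivative_intros u_R_field_differentiable y simp del: chol_l.simps)
    then have "(\<lambda>z. chi_sum n y z) field_differentiable at y"
      unfolding chi_sum_def by (intro derivative_intros) auto
    then show ?thesis .
  qed
  then obtain S' where "(chi_sum n y has_field_derivative S') (at y)"
    by (auto simp: field_differentiable_def)
  then have 1: "((\<lambda>z. (y - z) * chi_sum n y z) has_field_derivative - chi_sum n y y) (at y)"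
    by (auto intro!: derivative_eq_intros)
  have "(u_R \<omega> \<rho> c d \<alpha> n has_field_derivative deriv (u_R \<omega> \<rho> c d \<alpha> n) y) (at y)"
    using u_R_field_differentiable[OF y(1)] by (simp add: field_differentiable_derivI)
  then have 2: "((\<lambda>z. (z - ?e) * u_R \<omega> \<rho> c d \<alpha> n z * ?K) has_field_derivative
      (y - ?e) * deriv (u_R \<omega> \<rho> c d \<alpha> n) y * ?K) (at y)"
    by (auto intro!: derivative_eq_intros simp: uR)
  have cd: "(y - z) * chi_sum n y z = (z - ?e) * u_R \<omega> \<rho> c d \<alpha> n z * ?K" if "z \<noteq> ?e" for z
    using chi_sum_christoffel_darboux[OF assms(1) y(2) that] by (simp add: uL)
  have "eventually (\<lambda>z. z \<noteq> ?e) (nhds y)"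
    using y(1) by (intro t1_space_nhds)
  then have "eventually (\<lambda>z. (y - z) * chi_sum n y z = (z - ?e) * u_R \<omega> \<rho> c d \<alpha> n z * ?K) (nhds y)"
    by eventually_elim (rule cd)
  then have "((\<lambda>z. (y - z) * chi_sum n y z) has_field_derivative
      (y - ?e) * deriv (u_R \<omega> \<rho> c d \<alpha> n) y * ?K) (at y)"
    using 2 by (subst DERIV_cong_ev) auto
  from DERIV_unique[OF 1 this] have "chi_sum n y y = - ((y - ?e) * deriv (u_R \<omega> \<rho> c d \<alpha> n) y * ?K)"
    by (metis minus_minus)
  then show ?thesis by (simp add: algebra_simps)
qed

lemma diagonal_weight_recip_nonzero:
  assumes "n \<ge> 1" "Lc n y = 0"
  shows "- of_real (sqrt (d n)) * (y - \<i> * of_real \<omega>)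
    * deriv (u_R \<omega> \<rho> c d \<alpha> n) y * u_L \<omega> \<rho> c d \<alpha> (n - 1) y \<noteq> 0"
  using chi_sum_cnj_nonzero[OF assms(1), of y] zero_real[OF assms] chi_sum_diagonal[OF assms]
  by simp

text \<open>A zero is simple because the derivative of \<open>u\<^sub>n\<^sup>R\<close> does not vanish there.\<close>

lemma order_zero_le_1:
  assumes "n \<ge> 1" "Lc n y = 0"
  shows "order y (L_cpoly \<omega> \<rho> c d \<alpha> n) \<le> 1"
proof (rule ccontr)
  let ?p = "L_cpoly \<omega> \<rho> c d \<alpha> n"
  assume "\<not> ?thesis"
  then have "[:- y, 1:] ^ 2 dvd ?p" by (subst order_divides) auto
  then obtain q where q: "?p = [:- y, 1:] ^ 2 * q" by (rule dvdE)
  have pd: "poly (pderiv ?p) y = 0"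
    unfolding q power2_eq_square pderiv_mult poly_add poly_mult by simp
  note y = zero_not_pole[OF assms(2)]
  have "((\<lambda>z. u_R \<omega> \<rho> c d \<alpha> n z) has_field_derivative 0) (at y)"
    unfolding u_R_def using assms y prod_sqrt_d_nonzero[of n]
    by (auto intro!: derivative_eq_intros simp: pd)
  then have "deriv (u_R \<omega> \<rho> c d \<alpha> n) y = 0"
    by (simp add: DERIV_imp_deriv)
  then show False using diagonal_weight_recip_nonzero[OF assms] by simp
qed

end

section \<open>Biorthogonality\<close>

theorem theorem3p3:
  fixes \<omega> :: real and \<rho> c d \<alpha> :: "nat \<Rightarrow> real" and n :: nat and x :: "nat \<Rightarrow> complex"
  assumes "\<omega> \<noteq> 0"
    and "\<And>k. \<rho> k \<ge> 1"
    and "positive_chain_sequence d"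
    and "\<And>k. \<alpha> k \<noteq> 0"
    and "\<And>k. k \<ge> 1 \<Longrightarrow> \<alpha> k = \<rho> (k - 1) * (1 - c (k - 1)) - \<omega>\<^sup>2 * inverse (\<alpha> (k - 1)) * d (k - 1)"
    and "\<And>k. k \<ge> 1 \<Longrightarrow> d k * \<alpha> (k - 1) * \<rho> (k - 1) = d (k - 1) * \<alpha> k * \<rho> k"
    and "n \<ge> 1"
    and "image_mset x (mset_set {1..n}) = proots (L_cpoly \<omega> \<rho> c d \<alpha> n)"
  shows "\<forall>j\<in>{1..n}. \<forall>k\<in>{1..n}.
           weight_recip \<omega> \<rho> c d \<alpha> x n j k \<noteq> 0 \<and>
           (\<Sum>i=0..n-1. chi \<rho> d n (u_L \<omega> \<rho> c d \<alpha>) i (x j) * chi \<rho> d n (u_R \<omega> \<rho> c d \<alpha>) i (x k)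
               * weight \<omega> \<rho> c d \<alpha> x n j k) = (if j = k then 1 else 0)"
proof -
  interpret RII_quasi_orthogonal \<omega> \<rho> c d \<alpha>
    by unfold_locales (fact assms)+
  let ?p = "L_cpoly \<omega> \<rho> c d \<alpha> n"
  have "Lc n (\<i> * of_real \<omega>) \<noteq> 0"
    by (rule Lc_nonzero_at_pole) (simp add: power_mult_distrib)
  then have p: "?p \<noteq> 0" by auto
  have zero: "Lc n (x j) = 0" if "j \<in> {1..n}" for j
  proof -
    have "x j \<in># proots ?p" using that by (simp flip: assms(8))
    then show ?thesis using p by simp
  qed
  have inj: "x j \<noteq> x k" if "j \<in> {1..n}" "k \<in> {1..n}" "j \<noteq> k" for j k
  proof
    \<comment> \<open>The common value would be a zero of multiplicity at least 2.\<close>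
    assume eq: "x j = x k"
    have "mset_set {j, k} \<subseteq># mset_set {1..n}"
      using that by (intro subset_imp_msubset_mset_set) auto
    then have "image_mset x (mset_set {j, k}) \<subseteq># proots ?p"
      unfolding assms(8)[symmetric] by (rule image_mset_subseteq_mono)
    then have "count (image_mset x (mset_set {j, k})) (x j) \<le> order (x j) ?p"
      using p by (metis count_proots mset_subset_eq_count)
    moreover have "count (image_mset x (mset_set {j, k})) (x j) = 2"
      using that eq by simp
    ultimately show False
      using order_zero_le_1[OF assms(7) zero[OF that(1)]] by simp
  qed
  show ?thesis
  proof (intro ballI)
    fix j k assume j: "j \<in> {1..n}" and k: "k \<in> {1..n}"
    let ?w = "weight_recip \<omega> \<rho> c d \<alpha> x n j k"
    have w: "?w \<noteq> 0"
      using diagonal_weight_recip_nonzero[OF assms(7) zero[OF j]]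
        diagonal_weight_recip_nonzero[OF assms(7) zero[OF k]]
      by (simp add: weight_recip_def)
    have sum: "(\<Sum>i=0..n-1. chi \<rho> d n (u_L \<omega> \<rho> c d \<alpha>) i (x j) * chi \<rho> d n (u_R \<omega> \<rho> c d \<alpha>) i (x k)
               * weight \<omega> \<rho> c d \<alpha> x n j k) = chi_sum n (x j) (x k) * inverse ?w"
      by (simp add: chi_sum_def sum_distrib_right weight_def)
    have val: "chi_sum n (x j) (x k) = (if j = k then ?w else 0)"
    proof (cases "j = k")
      case True
      then show ?thesis
        using chi_sum_diagonal[OF assms(7) zero[OF k]] by (simp add: weight_recip_def)
    next
      case False
      have "(x j - x k) * chi_sum n (x j) (x k) = 0"
        using zero_not_pole[OF zero[OF j]] zero_not_pole[OF zero[OF k]] zero[OF j] zero[OF k] assms(7)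
        by (subst chi_sum_christoffel_darboux) (auto simp: u_R_def u_L_def)
      then show ?thesis using inj[OF j k False] False by simp
    qed
    then show "?w \<noteq> 0 \<and> (\<Sum>i=0..n-1. chi \<rho> d n (u_L \<omega> \<rho> c d \<alpha>) i (x j)
        * chi \<rho> d n (u_R \<omega> \<rho> c d \<alpha>) i (x k) * weight \<omega> \<rho> c d \<alpha> x n j k) = (if j = k then 1 else 0)"
      using w unfolding sum val by (cases "j = k") simp_all
  qed
qed

end
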